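(* Let $G$ be a group. The coarse space $\stackrel{\leftrightarrow}{G}$ is $n$-discrete for some $n\in\mathbb{N}$ if and only if the commutant $[G,G]$ of $G$ is finite.
   Context: A coarse structure on a set $X$ is a family $\mathcal{E}$ of subsets of $X\times X$ such that: each $E\in\mathcal{E}$ contains the diagonal $\Delta_X=\{(x,x):x\in X\}$; if $E,E'\in\mathcal{E}$ then $E\circ E'=\{(x,y):\exists z\,((x,z)\in E,\ (z,y)\in E')\}\in\mathcal{E}$ and $E^{-1}=\{(y,x):(x,y)\in E\}\in\mathcal{E}$; if $E\in\mathcal{E}$ and $\Delta_X\subseteq E'\subseteq E$ then $E'\in\mathcal{E}$. The pair $(X,\mathcal{E})$ is a coarse space. A subfamily $\mathcal{E}'\subseteq\mathcal{E}$ is a base for $\mathcal{E}$ if every $E\in\mathcal{E}$ is contained in some $E'\in\mathcal{E}'$. For $x\in X$ and $A\subseteq X$ put $E[x]=\{y\in X:(x,y)\in E\}$, $E[A]=\bigcup_{a\in A}E[a]$, $E_A[x]=E[x]\cap A$. A subset $B\subseteq X$ is bounded if there are a finite $F\subseteq X$ and $E\in\mathcal{E}$ with $B\subseteq E[F]$. For $n\in\mathbb{N}$, a subset $A\subseteq X$ is $n$-discrete if for every $E\in\mathcal{E}$ there is a bounded $B\subseteq X$ such that $|E_A[a]|\le n$ for each $a\in A\setminus B$. The coarse space $(X,\mathcal{E})$ is $n$-discrete if $A=X$ is $n$-discrete. For a group $G$ with identity $e$, $x,g\in G$ and $F\subseteq G$, write $x^g=g^{-1}xg$ and $x^F=\{x^y:y\in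 F\}$. $\stackrel{\leftrightarrow}{G}$ denotes the set $G$ endowed with the coarse structure having base $\{\{(x,y)\in G\times G: y\in x^F\}: F\subseteq G \text{ finite},\ e\in F\}$. The commutant $[G,G]$ is the commutator (derived) subgroup of $G$. *)

theory Defs
  imports "HOL-Algebra.Generated_Groups"
begin

definition coarse_structure :: "'a set \<Rightarrow> ('a \<times> 'a) set set \<Rightarrow> bool" where
  "coarse_structure X \<E> \<longleftrightarrow>
     (\<forall>E\<in>\<E>. E \<subseteq> X \<times> X \<and> Id_on X \<subseteq> E) \<and>
     (\<forall>E\<in>\<E>. \<forall>E'\<in>\<E>. E O E' \<in> \<E>) \<and>
     (\<forall>E\<in>\<E>. E\<inverse> \<in> \<E>) \<and>
     (\<forall>E\<in>\<E>. \<forall>E'. Id_on X \<subseteq> E' \<and> E' \<subseteq> E \<longrightarrow> E' \<in> \<E>)"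

definition coarse_base :: "('a \<times> 'a) set set \<Rightarrow> ('a \<times> 'a) set set \<Rightarrow> bool" where
  "coarse_base \<E> \<B> \<longleftrightarrow> \<B> \<subseteq> \<E> \<and> (\<forall>E\<in>\<E>. \<exists>E'\<in>\<B>. E \<subseteq> E')"

text \<open>The only candidate for a coarse structure on \<open>X\<close> with base \<open>\<B>\<close>; see the next lemma.\<close>

definition coarse_generated :: "'a set \<Rightarrow> ('a \<times> 'a) set set \<Rightarrow> ('a \<times> 'a) set set" where
  "coarse_generated X \<B> = {E. Id_on X \<subseteq> E \<and> (\<exists>E'\<in>\<B>. E \<subseteq> E')}"

lemma coarse_generated_unique:
  assumes "coarse_structure X \<E>" and "coarse_base \<E> \<B>"
  shows "\<E> = coarse_generated X \<B>"
proof (rule Set.set_eqI)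
  fix E
  show "E \<in> \<E> \<longleftrightarrow> E \<in> coarse_generated X \<B>"
    using assms unfolding coarse_structure_def coarse_base_def coarse_generated_def mem_Collect_eq
    by (meson subsetD)
qed

definition coarse_bounded :: "'a set \<Rightarrow> ('a \<times> 'a) set set \<Rightarrow> 'a set \<Rightarrow> bool" where
  "coarse_bounded X \<E> B \<longleftrightarrow>
     B \<subseteq> X \<and> (\<exists>F E. finite F \<and> F \<subseteq> X \<and> E \<in> \<E> \<and> B \<subseteq> E `` F)"

text \<open>The explicit finiteness is needed because \<^const>\<open>card\<close> is \<open>0\<close> on infinite sets.\<close>

definition n_discrete :: "'a set \<Rightarrow> ('a \<times> 'a) set set \<Rightarrow> nat \<Rightarrow> 'a set \<Rightarrow> bool" where
  "n_discrete X \<E> n A \<longleftrightarrow> A \<subseteq> X \<and>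
     (\<forall>E\<in>\<E>. \<exists>B. coarse_bounded X \<E> B \<and>
        (\<forall>a\<in>A - B. finite (E `` {a} \<inter> A) \<and> card (E `` {a} \<inter> A) \<le> n))"

definition n_discrete_space :: "'a set \<Rightarrow> ('a \<times> 'a) set set \<Rightarrow> nat \<Rightarrow> bool" where
  "n_discrete_space X \<E> n \<longleftrightarrow> n_discrete X \<E> n X"

definition conj_set :: "('a, 'b) monoid_scheme \<Rightarrow> 'a \<Rightarrow> 'a set \<Rightarrow> 'a set" where
  "conj_set G x F = {inv\<^bsub>G\<^esub> g \<otimes>\<^bsub>G\<^esub> x \<otimes>\<^bsub>G\<^esub> g | g. g \<in> F}"

definition conj_base :: "('a, 'b) monoid_scheme \<Rightarrow> ('a \<times> 'a) set set" where
  "conj_base G = {{(x, y). x \<in> carrier G \<and> y \<in> carrier G \<and> y \<in> conj_set G x F} | F.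
     F \<subseteq> carrier G \<and> finite F \<and> \<one>\<^bsub>G\<^esub> \<in> F}"

definition conj_coarse :: "('a, 'b) monoid_scheme \<Rightarrow> ('a \<times> 'a) set set" where
  "conj_coarse G = coarse_generated (carrier G) (conj_base G)"

lemma (in group) conj_base_comp:
  assumes "B \<in> conj_base G" "B' \<in> conj_base G"
  shows "\<exists>C\<in>conj_base G. B O B' \<subseteq> C"
proof -
  obtain F where F: "F \<subseteq> carrier G" "finite F" "\<one> \<in> F"
    "B = {(x, y). x \<in> carrier G \<and> y \<in> carrier G \<and> y \<in> conj_set G x F}"
    using assms(1) unfolding conj_base_def by blast
  obtain F' where F': "F' \<subseteq> carrier G" "finite F'" "\<one> \<in> F'"
    "B' = {(x, y). x \<in> carrier G \<and> y \<in> carrier G \<and> y \<in> conj_set G x F'}"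
    using assms(2) unfolding conj_base_def by blast
  define H where "H = (\<lambda>(g, h). g \<otimes> h) ` (F \<times> F')"
  have H: "H \<subseteq> carrier G" "finite H" using F(1,2) F'(1,2) by (auto simp: H_def)
  have "\<one> = (\<lambda>(g, h). g \<otimes> h) (\<one>, \<one>)" by simp
  then have one: "\<one> \<in> H" unfolding H_def using F(3) F'(3) by blast
  have "inv h \<otimes> (inv g \<otimes> x \<otimes> g) \<otimes> h \<in> conj_set G x H"
    if "x \<in> carrier G" "g \<in> F" "h \<in> F'" for x g h
  proof -
    have "g \<otimes> h \<in> H" using that by (auto simp: H_def)
    moreover have "g \<in> carrier G" "h \<in> carrier G" using that F(1) F'(1) by auto
    then have "inv h \<otimes> (inv g \<otimes> x \<otimes> g) \<otimes> h = inv (g \<otimes> h) \<otimes> x \<otimes> (g \<otimes> h)"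
      using that(1) by (simp add: inv_mult_group m_assoc)
    ultimately show ?thesis unfolding conj_set_def by blast
  qed
  then have "B O B' \<subseteq> {(x, y). x \<in> carrier G \<and> y \<in> carrier G \<and> y \<in> conj_set G x H}"
    unfolding F(4) F'(4) by (fastforce simp: conj_set_def[of _ _ F] conj_set_def[of _ _ F'])
  then show ?thesis using H one unfolding conj_base_def by blast
qed

lemma (in group) conj_base_converse:
  assumes "B \<in> conj_base G"
  shows "\<exists>C\<in>conj_base G. B\<inverse> \<subseteq> C"
proof -
  obtain F where F: "F \<subseteq> carrier G" "finite F" "\<one> \<in> F"
    "B = {(x, y). x \<in> carrier G \<and> y \<in> carrier G \<and> y \<in> conj_set G x F}"
    using assms(1) unfolding conj_base_def by blast
  define H where "H = m_inv G ` F"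
  have H: "H \<subseteq> carrier G" "finite H" using F(1,2) by (auto simp: H_def)
  have "\<one> = inv \<one>" by simp
  then have one: "\<one> \<in> H" unfolding H_def using F(3) by blast
  have "x \<in> conj_set G (inv g \<otimes> x \<otimes> g) H" if "x \<in> carrier G" "g \<in> F" for x g
  proof -
    have "g \<in> carrier G" using that F(1) by auto
    moreover have "g \<otimes> (inv g \<otimes> (x \<otimes> (g \<otimes> inv g))) = (g \<otimes> inv g) \<otimes> (x \<otimes> (g \<otimes> inv g))"
      using that(1) calculation by (simp only: m_assoc inv_closed m_closed)
    ultimately have "x = inv (inv g) \<otimes> (inv g \<otimes> x \<otimes> g) \<otimes> inv g"
      using that(1) by (simp add: m_assoc)
    then show ?thesis using that(2) unfolding conj_set_def H_def by blast
  qed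
  then have "B\<inverse> \<subseteq> {(x, y). x \<in> carrier G \<and> y \<in> carrier G \<and> y \<in> conj_set G x H}"
    unfolding F(4) by (auto simp: conj_set_def[of _ _ F])
  then show ?thesis using H one unfolding conj_base_def by blast
qed

lemma coarse_structure_generated:
  assumes sub: "\<And>B. B \<in> \<B> \<Longrightarrow> B \<subseteq> X \<times> X"
    and comp: "\<And>B B'. B \<in> \<B> \<Longrightarrow> B' \<in> \<B> \<Longrightarrow> \<exists>C\<in>\<B>. B O B' \<subseteq> C"
    and conv: "\<And>B. B \<in> \<B> \<Longrightarrow> \<exists>C\<in>\<B>. B\<inverse> \<subseteq> C"
  shows "coarse_structure X (coarse_generated X \<B>)"
proof -
  have mem: "E \<in> coarse_generated X \<B> \<longleftrightarrow> Id_on X \<subseteq> E \<and> (\<exists>B\<in>\<B>. E \<subseteq> B)" for E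
    by (simp add: coarse_generated_def)
  have 1: "E O E' \<in> coarse_generated X \<B>"
    if E: "E \<in> coarse_generated X \<B>" and E': "E' \<in> coarse_generated X \<B>" for E E'
  proof -
    obtain B where B: "B \<in> \<B>" "E \<subseteq> B" using E mem by meson
    obtain B' where B': "B' \<in> \<B>" "E' \<subseteq> B'" using E' mem by meson
    obtain C where C: "C \<in> \<B>" "B O B' \<subseteq> C" using comp[OF B(1) B'(1)] by meson
    have "E O E' \<subseteq> C" using relcomp_mono[OF B(2) B'(2)] C(2) by (rule order_trans)
    moreover have "Id_on X \<subseteq> E" "Id_on X \<subseteq> E'" using E E' mem by simp_all
    then have "Id_on X \<subseteq> E O E'" by (auto simp: Id_on_def)
    ultimately show ?thesis using C(1) mem by meson
  qed
  have 2: "E\<inverse> \<in> coarse_generated X \<B>" if E: "E \<in> coarse_generated X \<B>" for E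
  proof -
    obtain B where B: "B \<in> \<B>" "E \<subseteq> B" using E mem by meson
    obtain C where C: "C \<in> \<B>" "B\<inverse> \<subseteq> C" using conv[OF B(1)] by meson
    have "E\<inverse> \<subseteq> C" using B(2) C(2) by auto
    moreover have "Id_on X \<subseteq> E" using E mem by simp
    then have "Id_on X \<subseteq> E\<inverse>" by (auto simp: Id_on_def)
    ultimately show ?thesis using C(1) mem by meson
  qed
  have 3: "E \<subseteq> X \<times> X \<and> Id_on X \<subseteq> E" if "E \<in> coarse_generated X \<B>" for E
    using that mem sub by (meson order_trans)
  have 4: "E' \<in> coarse_generated X \<B>"
    if "E \<in> coarse_generated X \<B>" "Id_on X \<subseteq> E' \<and> E' \<subseteq> E" for E E'
    using that mem by (meson order_trans)
  show ?thesis unfolding coarse_structure_def using 1 2 3 4 by meson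
qed

lemma (in group) coarse_structure_conj_coarse:
  "coarse_structure (carrier G) (conj_coarse G)"
  unfolding conj_coarse_def
proof (rule coarse_structure_generated)
  show "B \<subseteq> carrier G \<times> carrier G" if "B \<in> conj_base G" for B
    using that by (auto simp: conj_base_def)
qed (fact conj_base_comp conj_base_converse)+

lemma (in group) coarse_base_conj_base: "coarse_base (conj_coarse G) (conj_base G)"
proof -
  have "Id_on (carrier G) \<subseteq> B" if B: "B \<in> conj_base G" for B
  proof -
    obtain F where F: "\<one> \<in> F"
      "B = {(x, y). x \<in> carrier G \<and> y \<in> carrier G \<and> y \<in> conj_set G x F}"
      using B unfolding conj_base_def by blast
    have "x \<in> conj_set G x F" if "x \<in> carrier G" for x
    proof -
      have "x = inv \<one> \<otimes> x \<otimes> \<one>" using that by simp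
      then show ?thesis using F(1) unfolding conj_set_def by blast
    qed
    then show ?thesis using F(2) by auto
  qed
  then show ?thesis by (auto simp: coarse_base_def conj_coarse_def coarse_generated_def)
qed

end

(* Bounded sets are the finite ones, so n-discreteness says that for every finite F, all but
   finitely many x satisfy |x^F| <= n. In an infinite group, writing x as a product of two
   non-exceptional elements gives |x^F| <= n^2 for all x and F, so the conjugacy classes have
   at most n^2 elements. Then B. H. Neumann's theorem applies: comparing with an element whose
   class is largest shows that there are only finitely many commutators. Moreover, if a power
   c^m of a commutator c = [a,b] commutes with b, then c^(m+1) = [a,b^2] (b c b^-1)^(m-1) is a
   product of m commutators, so long words in the commutators can be shortened and the
   commutant is finite. Conversely, x^G is contained in x [G,G]. *)
theory Submission
  imports Defs
begin

context group
begin

section \<open>Conjugation and the set of commutators\<close>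

text \<open>Once \<open>m_assoc\<close> has bracketed a product to the right, an element and its
  inverse meet at the head of a longer product, where \<open>l_inv\<close> and \<open>r_inv\<close>
  do not match.\<close>

lemma inv_mult_cancel [simp]:
  assumes "x \<in> carrier G" "y \<in> carrier G"
  shows "inv x \<otimes> (x \<otimes> y) = y" "x \<otimes> (inv x \<otimes> y) = y"
  using assms by (simp_all flip: m_assoc)

lemma conj_set_eq_image: "conj_set G x F = (\<lambda>g. inv g \<otimes> x \<otimes> g) ` F"
  by (auto simp: conj_set_def)

abbreviation conj_class :: "'a \<Rightarrow> 'a set" where
  "conj_class x \<equiv> conj_set G x (carrier G)"

lemma conj_class_closed:
  assumes "x \<in> carrier G" "y \<in> conj_class x"
  shows "y \<in> carrier G"
  using assms by (auto simp: conj_set_def)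

lemma derived_setI:
  assumes "a \<in> carrier G" "b \<in> carrier G"
  shows "a \<otimes> b \<otimes> inv a \<otimes> inv b \<in> derived_set G (carrier G)"
  using assms by blast

lemma derived_setE:
  assumes "c \<in> derived_set G (carrier G)"
  obtains a b where "a \<in> carrier G" "b \<in> carrier G" "c = a \<otimes> b \<otimes> inv a \<otimes> inv b"
  using assms by blast

lemma derived_set_closed: "derived_set G (carrier G) \<subseteq> carrier G"
  by auto

text \<open>Conjugation by g is an automorphism, so it takes [a,b] to the commutator of the
  conjugates of a and b.\<close>

lemma derived_set_conj:
  assumes "c \<in> derived_set G (carrier G)" "g \<in> carrier G"
  shows "inv g \<otimes> c \<otimes> g \<in> derived_set G (carrier G)"
proof -
  obtain a b where ab: "a \<in> carrier G" "b \<in> carrier G" "c = a \<otimes> b \<otimes> inv a \<otimes> inv b"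
    using assms(1) by (rule derived_setE)
  then have "inv g \<otimes> c \<otimes> g = (inv g \<otimes> a \<otimes> g) \<otimes> (inv g \<otimes> b \<otimes> g)
      \<otimes> inv (inv g \<otimes> a \<otimes> g) \<otimes> inv (inv g \<otimes> b \<otimes> g)"
    using assms(2) by (simp add: m_assoc inv_mult_group)
  then show ?thesis using derived_setI ab assms(2) by simp
qed

lemma derived_set_inv:
  assumes "c \<in> derived_set G (carrier G)"
  shows "inv c \<in> derived_set G (carrier G)"
proof -
  obtain a b where ab: "a \<in> carrier G" "b \<in> carrier G" "c = a \<otimes> b \<otimes> inv a \<otimes> inv b"
    using assms by (rule derived_setE)
  then have "inv c = b \<otimes> a \<otimes> inv b \<otimes> inv a"
    by (simp add: m_assoc inv_mult_group)
  then show ?thesis using derived_setI[OF ab(2,1)] by simp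
qed

section \<open>Words over a conjugation-invariant set\<close>

primrec word_prod :: "'a list \<Rightarrow> 'a" where
  "word_prod [] = \<one>"
| "word_prod (x # xs) = x \<otimes> word_prod xs"

lemma word_prod_closed:
  assumes "set xs \<subseteq> carrier G"
  shows "word_prod xs \<in> carrier G"
  using assms by (induction xs) auto

lemma word_prod_append:
  assumes "set xs \<subseteq> carrier G" "set ys \<subseteq> carrier G"
  shows "word_prod (xs @ ys) = word_prod xs \<otimes> word_prod ys"
  using assms by (induction xs) (auto simp: word_prod_closed m_assoc)

lemma word_prod_replicate:
  assumes "x \<in> carrier G"
  shows "word_prod (replicate k x) = x [^] k"
  using assms by (induction k) (auto simp flip: nat_pow_Suc2)

text \<open>Moving a letter past a power of c replaces it by a conjugate, which is again a letter.
  So all copies of c can be collected in front without changing the length.\<close>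

lemma word_prod_collect:
  assumes K: "K \<subseteq> carrier G"
    and conj: "\<And>c g. c \<in> K \<Longrightarrow> g \<in> carrier G \<Longrightarrow> inv g \<otimes> c \<otimes> g \<in> K"
    and c: "c \<in> K" and xs: "set xs \<subseteq> K"
  shows "\<exists>ys. set ys \<subseteq> K \<and> length ys + count_list xs c = length xs \<and>
           word_prod xs = c [^] count_list xs c \<otimes> word_prod ys"
  using xs
proof (induction xs)
  case Nil
  show ?case by (rule exI[of _ "[]"]) simp
next
  case (Cons x xs)
  then obtain ys where ys: "set ys \<subseteq> K" "length ys + count_list xs c = length xs"
      "word_prod xs = c [^] count_list xs c \<otimes> word_prod ys"
    by auto
  let ?k = "count_list xs c"
  have cl: "x \<in> carrier G" "c \<in> carrier G" "word_prod ys \<in> carrier G"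
    using Cons.prems K c ys(1) word_prod_closed by auto
  show ?case
  proof (cases "x = c")
    case True
    have "c \<otimes> c [^] ?k = c [^] ?k \<otimes> c"
      using cl(2) by (metis nat_pow_Suc nat_pow_Suc2)
    then have "c \<otimes> (c [^] ?k \<otimes> word_prod ys) = c [^] ?k \<otimes> (c \<otimes> word_prod ys)"
      using cl by (simp flip: m_assoc)
    then show ?thesis
      using True cl ys by (intro exI[of _ ys]) (simp add: m_assoc)
  next
    case False
    \<comment> \<open>Chosen so that
      \<open>x \<otimes> c [^] ?k = c [^] ?k \<otimes> ?z\<close>.\<close>
    let ?z = "inv (c [^] ?k) \<otimes> x \<otimes> c [^] ?k"
    have "?z \<in> K" using conj[of x "c [^] ?k"] Cons.prems cl by simp
    then show ?thesis
      using False cl ys by (intro exI[of _ "?z # ys"]) (auto simp: m_assoc)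
  qed
qed

text \<open>A long word contains some letter \<open>c\<close> more than \<open>m c\<close> times. Collecting these
  occurrences at the front and rewriting the power of \<open>c\<close> shortens the word.\<close>

lemma word_prod_shorten:
  assumes fin: "finite K" and K: "K \<subseteq> carrier G"
    and conj: "\<And>c g. c \<in> K \<Longrightarrow> g \<in> carrier G \<Longrightarrow> inv g \<otimes> c \<otimes> g \<in> K"
    and pow: "\<And>c. c \<in> K \<Longrightarrow> \<exists>zs. set zs \<subseteq> K \<and> length zs = m c \<and> c [^] Suc (m c) = word_prod zs"
    and xs: "set xs \<subseteq> K"
  shows "\<exists>ys. set ys \<subseteq> K \<and> length ys \<le> sum m K \<and> word_prod ys = word_prod xs"
  using xs
proof (induction "length xs" arbitrary: xs rule: less_induct)
  case less
  show ?case
  proof (cases "length xs \<le> sum m K")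
    case True
    then show ?thesis using less.prems by blast
  next
    case False
    have "length xs = (\<Sum>c\<in>set xs. count_list xs c)"
      by (simp add: sum_count_set)
    also have "\<dots> \<le> (\<Sum>c\<in>K. count_list xs c)"
      using less.prems fin by (intro sum_mono2) auto
    \<comment> \<open>If every letter c occurred at most m c times, the length would be at most
      \<open>sum m K\<close>.\<close>
    finally have "\<exists>c\<in>K. m c < count_list xs c"
      using False by (meson order_trans sum_mono not_less)
    then obtain c where c: "c \<in> K" "m c < count_list xs c" by blast
    obtain ys where ys: "set ys \<subseteq> K" "length ys + count_list xs c = length xs"
      "word_prod xs = c [^] count_list xs c \<otimes> word_prod ys"
      using word_prod_collect[OF K conj c(1) less.prems] by blast
    obtain zs where zs: "set zs \<subseteq> K" "length zs = m c" "c [^] Suc (m c) = word_prod zs"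
      using pow[OF c(1)] by blast
    obtain k where k: "count_list xs c = Suc (m c) + k"
      using c(2) by (metis less_iff_Suc_add add_Suc)
    \<comment> \<open>The block of \<open>Suc (m c)\<close> copies of c becomes \<open>zs\<close>,
      which has only m c letters, so \<open>?ws\<close> is one letter shorter than
      \<open>xs\<close>.\<close>
    let ?ws = "zs @ replicate k c @ ys"
    have cl: "c \<in> carrier G" "set zs \<subseteq> carrier G" "set ys \<subseteq> carrier G"
      using c(1) K zs(1) ys(1) by auto
    have "word_prod ?ws = c [^] Suc (m c) \<otimes> (c [^] k \<otimes> word_prod ys)"
      using cl unfolding zs(3)
      by (metis word_prod_append word_prod_replicate set_append Un_least
          set_replicate_conv_if empty_subsetI insert_subset)
    also have "\<dots> = word_prod xs"
      unfolding ys(3) k using cl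
      by (metis nat_pow_mult m_assoc nat_pow_closed word_prod_closed)
    finally have "word_prod ?ws = word_prod xs" .
    moreover have "set ?ws \<subseteq> K" "length ?ws < length xs"
      using c(1) zs ys(1,2) k by auto
    ultimately show ?thesis using less.hyps by metis
  qed
qed

text \<open>The inverse of a letter is a letter, so words without formal inverses suffice.\<close>

lemma generate_subset_word_prods:
  assumes K: "K \<subseteq> carrier G" and inv: "\<And>c. c \<in> K \<Longrightarrow> inv c \<in> K"
  shows "generate G K \<subseteq> word_prod ` {xs. set xs \<subseteq> K}"
proof
  fix g assume "g \<in> generate G K"
  then have "\<exists>xs. set xs \<subseteq> K \<and> word_prod xs = g"
  proof induction
    case one
    show ?case by (rule exI[of _ "[]"]) simp
  next
    case (incl h)
    then show ?case using K by (intro exI[of _ "[h]"]) auto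
  next
    case (inv h)
    then show ?case using K assms(2) by (intro exI[of _ "[inv h]"]) auto
  next
    case (eng h1 h2)
    then obtain xs ys where "set xs \<subseteq> K" "word_prod xs = h1" "set ys \<subseteq> K" "word_prod ys = h2"
      by blast
    then show ?case using K by (intro exI[of _ "xs @ ys"]) (auto simp: word_prod_append)
  qed
  then show "g \<in> word_prod ` {xs. set xs \<subseteq> K}" by blast
qed

section \<open>Powers of commutators and finiteness of the commutant\<close>

text \<open>This trades k + 2 factors for k + 1, all of them commutators: [a,b^2] and k copies of a
  conjugate of c. The identity behind it is [a,b] (b [a,b] b^-1) = [a,b^2].\<close>

lemma commutator_power:
  assumes a: "a \<in> carrier G" and b: "b \<in> carrier G"
    and c: "c = a \<otimes> b \<otimes> inv a \<otimes> inv b"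
    and comm: "b \<otimes> c [^] Suc k = c [^] Suc k \<otimes> b"
  shows "c [^] Suc (Suc k) =
    (a \<otimes> (b \<otimes> b) \<otimes> inv a \<otimes> inv (b \<otimes> b)) \<otimes> (b \<otimes> c \<otimes> inv b) [^] k"
proof -
  have cc: "c \<in> carrier G" using a b c by simp
  have pow: "(b \<otimes> c \<otimes> inv b) [^] j = b \<otimes> c [^] j \<otimes> inv b" for j :: nat
    using b cc by (induction j) (auto simp: m_assoc)
  have "c [^] Suc (Suc k) = c \<otimes> c [^] Suc k"
    using cc by (metis nat_pow_Suc2)
  \<comment> \<open>As b commutes with c^(k+1), this power equals its own conjugate by b.\<close>
  also have "\<dots> = c \<otimes> (b \<otimes> c [^] Suc k \<otimes> inv b)"
    using b cc comm by (simp add: m_assoc)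
  also have "\<dots> = c \<otimes> (b \<otimes> (c \<otimes> c [^] k) \<otimes> inv b)"
    using cc by (metis nat_pow_Suc2)
  also have "\<dots> = (c \<otimes> b \<otimes> c \<otimes> inv b) \<otimes> (b \<otimes> c [^] k \<otimes> inv b)"
    using b cc by (simp add: m_assoc)
  also have "c \<otimes> b \<otimes> c \<otimes> inv b = a \<otimes> (b \<otimes> b) \<otimes> inv a \<otimes> inv (b \<otimes> b)"
    unfolding c using a b by (simp add: m_assoc inv_mult_group)
  finally show ?thesis unfolding pow .
qed

text \<open>Pigeonhole: the conjugates of b by the powers of c cannot all differ, and if c^i and c^j
  give the same one, then c^(j-i) centralises b.\<close>

lemma power_commutes_if_finite_conj_class:
  assumes b: "b \<in> carrier G" and c: "c \<in> carrier G" and fin: "finite (conj_class b)"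
  obtains k :: nat where "b \<otimes> c [^] Suc k = c [^] Suc k \<otimes> b"
proof -
  let ?f = "\<lambda>i::nat. inv (c [^] i) \<otimes> b \<otimes> c [^] i"
  have "range ?f \<subseteq> conj_class b" using c by (auto simp: conj_set_def)
  then have "\<not> inj ?f" using fin finite_subset finite_imageD by blast
  then obtain i j where ij: "i < j" "?f i = ?f j"
    unfolding inj_def by (metis linorder_neqE_nat)
  \<comment> \<open>The difference j - i is positive, hence of the form \<open>Suc k\<close>, as
    \<open>commutator_power\<close> requires.\<close>
  then obtain k where k: "j = Suc k + i"
    by (metis add.commute less_iff_Suc_add add_Suc_right)
  define p q where "p = c [^] i" and "q = c [^] Suc k"
  have pq: "p \<in> carrier G" "q \<in> carrier G" using c by (simp_all add: p_def q_def)
  have "c [^] j = q \<otimes> p"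
    unfolding k p_def q_def by (rule nat_pow_mult[OF c, symmetric])
  then have "inv p \<otimes> b \<otimes> p = inv (q \<otimes> p) \<otimes> b \<otimes> (q \<otimes> p)"
    using ij(2) by (simp add: p_def)
  then have "(q \<otimes> p) \<otimes> (inv p \<otimes> b \<otimes> p) \<otimes> inv p
      = (q \<otimes> p) \<otimes> (inv (q \<otimes> p) \<otimes> b \<otimes> (q \<otimes> p)) \<otimes> inv p"
    by simp
  then have "b \<otimes> q = q \<otimes> b"
    using pq b by (simp add: m_assoc inv_mult_group)
  then show ?thesis using that unfolding q_def by metis
qed

text \<open>Each element of the commutant is a word in the commutators. Shortening bounds the length
  of the words, and a finite alphabet has only finitely many words of bounded length.\<close>

lemma finite_derived_if_finite_derived_set:
  assumes fin: "finite (derived_set G (carrier G))"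
    and cls: "\<And>x. x \<in> carrier G \<Longrightarrow> finite (conj_class x)"
  shows "finite (derived G (carrier G))"
proof -
  define K where "K = derived_set G (carrier G)"
  have K: "finite K" "K \<subseteq> carrier G" "\<And>c. c \<in> K \<Longrightarrow> inv c \<in> K"
    "\<And>c g. c \<in> K \<Longrightarrow> g \<in> carrier G \<Longrightarrow> inv g \<otimes> c \<otimes> g \<in> K"
    unfolding K_def using fin derived_set_closed derived_set_inv derived_set_conj by - assumption+
  have "\<exists>m zs. set zs \<subseteq> K \<and> length zs = m \<and> c [^] Suc m = word_prod zs"
    if cK: "c \<in> K" for c
  proof -
    obtain a b where ab: "a \<in> carrier G" "b \<in> carrier G" "c = a \<otimes> b \<otimes> inv a \<otimes> inv b"
      using cK unfolding K_def by (rule derived_setE)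
    have c: "c \<in> carrier G" using ab by simp
    obtain k where "b \<otimes> c [^] Suc k = c [^] Suc k \<otimes> b"
      using power_commutes_if_finite_conj_class[OF ab(2) c cls[OF ab(2)]] .
    note pow = commutator_power[OF ab this]
    let ?d = "a \<otimes> (b \<otimes> b) \<otimes> inv a \<otimes> inv (b \<otimes> b)" and ?e = "b \<otimes> c \<otimes> inv b"
    have "?d \<in> K" using derived_setI[of a "b \<otimes> b"] ab unfolding K_def by simp
    moreover have "?e \<in> K" using K(4)[OF cK, of "inv b"] ab(2) by simp
    ultimately have 1: "set (?d # replicate k ?e) \<subseteq> K" by auto
    \<comment> \<open>The length m = k + 1 is one less than the exponent k + 2 below, which is what
      makes words shrink.\<close>
    have 2: "length (?d # replicate k ?e) = Suc k" by simp
    have 3: "c [^] Suc (Suc k) = word_prod (?d # replicate k ?e)"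
      unfolding pow using ab(2) c by (simp add: word_prod_replicate)
    show ?thesis by (rule exI, rule exI, rule conjI[OF 1 conjI[OF 2 3]])
  qed
  then have "\<forall>c. \<exists>m. c \<in> K \<longrightarrow>
      (\<exists>zs. set zs \<subseteq> K \<and> length zs = m \<and> c [^] Suc m = word_prod zs)"
    by blast
  then obtain m where m: "\<And>c. c \<in> K \<Longrightarrow>
      \<exists>zs. set zs \<subseteq> K \<and> length zs = m c \<and> c [^] Suc (m c) = word_prod zs"
    unfolding choice_iff by blast
  have "derived G (carrier G) \<subseteq> word_prod ` {xs. set xs \<subseteq> K}"
    using generate_subset_word_prods[OF K(2,3)] by (simp only: derived_def K_def)
  also have "\<dots> \<subseteq> word_prod ` {xs. set xs \<subseteq> K \<and> length xs \<le> sum m K}"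
  proof safe
    fix xs assume "set xs \<subseteq> K"
    then obtain ys where "set ys \<subseteq> K" "length ys \<le> sum m K" "word_prod ys = word_prod xs"
      using word_prod_shorten[OF K(1,2,4) m] by blast
    then show "word_prod xs \<in> word_prod ` {xs. set xs \<subseteq> K \<and> length xs \<le> sum m K}"
      by (intro image_eqI[of _ _ ys]) auto
  qed
  finally show ?thesis
    using finite_lists_length_le[OF K(1)] finite_surj by blast
qed

section \<open>Neumann's theorem: bounded conjugacy classes give finitely many commutators\<close>

text \<open>If \<open>x\<close> has a conjugacy class of maximal size, realised by conjugating with \<open>T\<close>, and \<open>c\<close>
  centralises \<open>T\<close>, then the class of \<open>c x\<close> must be \<open>c\<close> times the class of \<open>x\<close>. Hence the
  commutators with \<open>c\<close> lie in a finite set that does not depend on \<open>c\<close>.\<close>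

lemma commutator_mem_of_maximal_conj_class:
  assumes x: "x \<in> carrier G" and T: "T \<subseteq> carrier G" "conj_class x = conj_set G x T"
    and fin: "\<And>y. y \<in> carrier G \<Longrightarrow> finite (conj_class y)"
    and max: "\<And>y. y \<in> carrier G \<Longrightarrow> card (conj_class y) \<le> card (conj_class x)"
    and c: "c \<in> carrier G" "\<And>t. t \<in> T \<Longrightarrow> c \<otimes> t = t \<otimes> c" and z: "z \<in> carrier G"
  shows "\<exists>p\<in>conj_class x. \<exists>q\<in>conj_class x. inv c \<otimes> inv z \<otimes> c \<otimes> z = p \<otimes> inv q"
proof -
  have "(\<lambda>p. c \<otimes> p) ` conj_class x \<subseteq> conj_class (c \<otimes> x)"
  proof safe
    fix p assume "p \<in> conj_class x"
    then obtain t where t: "t \<in> T" "p = inv t \<otimes> x \<otimes> t"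
      using T(2) by (auto simp: conj_set_def)
    have tc: "t \<in> carrier G" using t T by blast
    have "c = inv t \<otimes> (c \<otimes> t)" using c t(1) tc by simp
    then have "c \<otimes> p = inv t \<otimes> (c \<otimes> t) \<otimes> p" by simp
    also have "\<dots> = inv t \<otimes> (c \<otimes> x) \<otimes> t"
      using c(1) t(2) tc x by (simp add: m_assoc)
    finally show "c \<otimes> p \<in> conj_class (c \<otimes> x)"
      using tc by (auto simp: conj_set_def)
  qed
  moreover have "card ((\<lambda>p. c \<otimes> p) ` conj_class x) = card (conj_class x)"
    using c(1) x conj_class_closed by (intro card_image inj_onI) (metis inv_mult_cancel(1))
  \<comment> \<open>The translate of the class of x lies in the class of c x, which is no larger
    because x was chosen maximal.\<close>
  ultimately have eq: "(\<lambda>p. c \<otimes> p) ` conj_class x = conj_class (c \<otimes> x)"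
    using fin max c(1) x by (metis card_seteq m_closed)
  let ?q = "inv z \<otimes> x \<otimes> z"
  have "inv z \<otimes> (c \<otimes> x) \<otimes> z \<in> conj_class (c \<otimes> x)"
    using z by (auto simp: conj_set_def)
  then obtain p where p: "p \<in> conj_class x" "inv z \<otimes> (c \<otimes> x) \<otimes> z = c \<otimes> p"
    unfolding eq[symmetric] by blast
  have pc: "p \<in> carrier G" using p(1) x conj_class_closed by blast
  \<comment> \<open>Multiplying by the inverse of z^-1 x z removes x from the conjugate of c x and
    leaves the commutator.\<close>
  have "inv c \<otimes> inv z \<otimes> c \<otimes> z = inv c \<otimes> (inv z \<otimes> (c \<otimes> x) \<otimes> z) \<otimes> inv ?q"
    using c(1) x z by (simp add: m_assoc inv_mult_group)
  also have "\<dots> = p \<otimes> inv ?q"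
    unfolding p(2) using c(1) pc x z by (simp add: m_assoc[symmetric])
  finally show ?thesis using p(1) z by (auto simp: conj_set_def)
qed

text \<open>The centraliser of T has finite index: g acts on T by conjugation in only finitely many
  ways, and two elements acting alike differ by an element that centralises T.\<close>

lemma finite_transversal_of_centralizer:
  assumes T: "finite T" "T \<subseteq> carrier G"
    and fin: "\<And>t. t \<in> T \<Longrightarrow> finite (conj_class t)"
  obtains S where "finite S" "S \<subseteq> carrier G"
    "\<And>g. g \<in> carrier G \<Longrightarrow>
       \<exists>s\<in>S. \<exists>c\<in>carrier G. g = s \<otimes> c \<and> (\<forall>t\<in>T. c \<otimes> t = t \<otimes> c)"
proof -
  \<comment> \<open>Restricting the function to T puts it into a finite extensional product of
    conjugacy classes.\<close>
  define f where "f g = (\<lambda>t\<in>T. g \<otimes> t \<otimes> inv g)" for g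
  have "g \<otimes> t \<otimes> inv g \<in> conj_class t" if "g \<in> carrier G" for g t
    using that unfolding conj_set_def by (auto intro!: exI[of _ "inv g"])
  then have "f ` carrier G \<subseteq> Pi\<^sub>E T conj_class" by (auto simp: f_def)
  then have "finite (f ` carrier G)"
    using T(1) fin by (meson finite_PiE finite_subset)
  then obtain S where S: "S \<subseteq> carrier G" "finite S" "f ` carrier G = f ` S"
    by (metis finite_subset_image order_refl)
  have "\<exists>s\<in>S. \<exists>c\<in>carrier G. g = s \<otimes> c \<and> (\<forall>t\<in>T. c \<otimes> t = t \<otimes> c)"
    if g: "g \<in> carrier G" for g
  proof -
    obtain s where s: "s \<in> S" "f g = f s" using S(3) g by (metis imageE imageI)
    have sc: "s \<in> carrier G" using s S by blast
    have "(inv s \<otimes> g) \<otimes> t = t \<otimes> (inv s \<otimes> g)" if t: "t \<in> T" for t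
    proof -
      have tc: "t \<in> carrier G" using t T by blast
      have "g \<otimes> t \<otimes> inv g = s \<otimes> t \<otimes> inv s"
        using fun_cong[OF s(2), of t] t by (simp add: f_def)
      then have "inv s \<otimes> (g \<otimes> t \<otimes> inv g) \<otimes> g = inv s \<otimes> (s \<otimes> t \<otimes> inv s) \<otimes> g" by simp
      then show ?thesis using g sc tc by (simp add: m_assoc)
    qed
    moreover have "g = s \<otimes> (inv s \<otimes> g)" using g sc by simp
    ultimately show ?thesis using s(1) sc g by blast
  qed
  then show ?thesis using that S by blast
qed

text \<open>Writing g = s c with s from a finite set and c centralising T gives [g,y] = s [c,y] s^-1
  [s,y]. Here [c,y] comes from the maximal class, and [s,y] is s times a conjugate of s^-1.\<close>

lemma finite_derived_set_if_bounded_conj_classes: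
  assumes fin: "\<And>x. x \<in> carrier G \<Longrightarrow> finite (conj_class x)"
    and bound: "\<And>x. x \<in> carrier G \<Longrightarrow> card (conj_class x) \<le> N"
  shows "finite (derived_set G (carrier G))"
proof -
  have "\<exists>x. x \<in> carrier G \<and> (\<forall>y. y \<in> carrier G \<longrightarrow> card (conj_class y) \<le> card (conj_class x))"
    using ex_has_greatest_nat[of "\<lambda>x. x \<in> carrier G" \<one> "\<lambda>x. card (conj_class x)" "Suc N"] bound
    by (auto simp: less_Suc_eq_le)
  then obtain x where x: "x \<in> carrier G"
      "\<And>y. y \<in> carrier G \<Longrightarrow> card (conj_class y) \<le> card (conj_class x)" by blast
  \<comment> \<open>The class of x is finite, so finitely many conjugators realise all of
    it.\<close>
  obtain T where T: "T \<subseteq> carrier G" "finite T" "conj_class x = conj_set G x T"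
    using finite_subset_image[OF fin[OF x(1)], of "\<lambda>g. inv g \<otimes> x \<otimes> g" "carrier G"]
    by (auto simp: conj_set_eq_image)
  obtain S where S: "finite S" "S \<subseteq> carrier G"
    "\<And>g. g \<in> carrier G \<Longrightarrow>
       \<exists>s\<in>S. \<exists>c\<in>carrier G. g = s \<otimes> c \<and> (\<forall>t\<in>T. c \<otimes> t = t \<otimes> c)"
    using finite_transversal_of_centralizer[OF T(2,1)] fin T(1) by blast
  let ?P = "conj_class x"
  let ?h = "\<lambda>(s, p, q, r). s \<otimes> (p \<otimes> inv q) \<otimes> inv s \<otimes> (s \<otimes> r)"
  let ?W = "SIGMA s:S. ?P \<times> ?P \<times> conj_class (inv s)"
  have "derived_set G (carrier G) \<subseteq> ?h ` ?W"
  proof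
    fix k assume "k \<in> derived_set G (carrier G)"
    then obtain g y where gy: "g \<in> carrier G" "y \<in> carrier G"
      "k = g \<otimes> y \<otimes> inv g \<otimes> inv y" by (rule derived_setE)
    obtain s c where sc: "s \<in> S" "c \<in> carrier G" "g = s \<otimes> c" "\<And>t. t \<in> T \<Longrightarrow> c \<otimes> t = t \<otimes> c"
      using S(3)[OF gy(1)] by blast
    have s: "s \<in> carrier G" using sc S by blast
    \<comment> \<open>The previous lemma treats commutators c^-1 z^-1 c z, so it is applied to the
      inverses of c and y; hence the inverse of c must centralise T.\<close>
    have "inv c \<otimes> t = t \<otimes> inv c" if "t \<in> T" for t
    proof -
      have t: "t \<in> carrier G" using that T by blast
      have "inv c \<otimes> (c \<otimes> t) \<otimes> inv c = inv c \<otimes> (t \<otimes> c) \<otimes> inv c" using sc(4) that by simp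
      then show ?thesis using t sc(2) by (simp add: m_assoc)
    qed
    then obtain p q where pq: "p \<in> ?P" "q \<in> ?P" "c \<otimes> y \<otimes> inv c \<otimes> inv y = p \<otimes> inv q"
      using commutator_mem_of_maximal_conj_class[OF x(1) T(1,3) fin x(2), of "inv c" "inv y"]
        sc(2) gy(2) by auto
    let ?r = "y \<otimes> inv s \<otimes> inv y"
    have "k = s \<otimes> (c \<otimes> y \<otimes> inv c \<otimes> inv y) \<otimes> inv s \<otimes> (s \<otimes> ?r)"
      using s sc(2) gy by (simp add: sc(3) m_assoc inv_mult_group)
    then have "k = ?h (s, p, q, ?r)" using pq(3) by simp
    moreover have "?r \<in> conj_class (inv s)"
      using gy(2) unfolding conj_set_def by (auto intro!: exI[of _ "inv y"])
    ultimately show "k \<in> ?h ` ?W" using sc(1) pq(1,2) by blast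
  qed
  moreover have "finite ?W"
    using S fin x(1) by (intro finite_SigmaI finite_cartesian_product) auto
  ultimately show ?thesis using finite_surj by blast
qed

section \<open>From discreteness to a uniform bound on conjugacy classes\<close>

text \<open>Conjugation is multiplicative, so each conjugate of x y is a product of conjugates of x
  and y by the same element.\<close>

lemma conj_set_mult_subset:
  assumes "x \<in> carrier G" "y \<in> carrier G" "F \<subseteq> carrier G"
  shows "conj_set G (x \<otimes> y) F \<subseteq> (\<lambda>(a, b). a \<otimes> b) ` (conj_set G x F \<times> conj_set G y F)"
proof
  fix w assume "w \<in> conj_set G (x \<otimes> y) F"
  then obtain g where g: "g \<in> F" "w = inv g \<otimes> (x \<otimes> y) \<otimes> g" by (auto simp: conj_set_def)
  then have "w = (inv g \<otimes> x \<otimes> g) \<otimes> (inv g \<otimes> y \<otimes> g)"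
    using assms by (auto simp: m_assoc subset_eq)
  then show "w \<in> (\<lambda>(a, b). a \<otimes> b) ` (conj_set G x F \<times> conj_set G y F)"
    using g(1) by (auto simp: conj_set_eq_image)
qed

lemma conj_class_bound:
  assumes inf: "infinite (carrier G)"
    and disc: "\<And>F. finite F \<Longrightarrow> F \<subseteq> carrier G \<Longrightarrow>
      finite {y \<in> carrier G. n < card (conj_set G y F)}"
    and x: "x \<in> carrier G"
  shows "finite (conj_class x)" "card (conj_class x) \<le> n * n"
proof -
  have le: "card (conj_set G x F) \<le> n * n" if F: "finite F" "F \<subseteq> carrier G" for F
  proof -
    let ?B = "{y \<in> carrier G. n < card (conj_set G y F)}"
    \<comment> \<open>Avoiding the first set makes y non-exceptional; avoiding the second does the
      same for y^-1 x, and x is the product of these two.\<close>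
    have "finite (?B \<union> (\<lambda>w. x \<otimes> inv w) ` ?B)" using disc[OF F] by simp
    then obtain y where y: "y \<in> carrier G" "y \<notin> ?B" "y \<notin> (\<lambda>w. x \<otimes> inv w) ` ?B"
      using Diff_infinite_finite[OF _ inf] infinite_imp_nonempty by blast
    have "y = x \<otimes> inv (inv y \<otimes> x)"
      using x y(1) by (simp add: inv_mult_group)
    then have yx: "inv y \<otimes> x \<notin> ?B" using y(3) by blast
    have fin: "finite (conj_set G w F)" for w using F(1) by (simp add: conj_set_eq_image)
    have "conj_set G x F = conj_set G (y \<otimes> (inv y \<otimes> x)) F" using x y(1) by simp
    also have "\<dots> \<subseteq> (\<lambda>(a, b). a \<otimes> b) ` (conj_set G y F \<times> conj_set G (inv y \<otimes> x) F)"
      using x y(1) F(2) by (intro conj_set_mult_subset) auto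
    finally have "card (conj_set G x F) \<le> card (conj_set G y F \<times> conj_set G (inv y \<otimes> x) F)"
      by (rule surj_card_le[OF finite_cartesian_product[OF fin fin]])
    also have "\<dots> \<le> n * n"
      unfolding card_cartesian_product using y(1,2) yx x by (intro mult_le_mono) auto
    finally show ?thesis .
  qed
  \<comment> \<open>The bound does not depend on F, and every finite part of the class is x^F for
    some finite F, so the bound passes to the whole class.\<close>
  have sub: "card A \<le> n * n" if A: "finite A" "A \<subseteq> conj_class x" for A
  proof -
    obtain F where "F \<subseteq> carrier G" "finite F" "A = conj_set G x F"
      using finite_subset_image[OF A[unfolded conj_set_eq_image]]
      unfolding conj_set_eq_image by blast
    then show ?thesis using le by simp
  qed
  show fin: "finite (conj_class x)"
  proof (rule ccontr)
    assume "infinite (conj_class x)"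
    then obtain A where "finite A" "card A = Suc (n * n)" "A \<subseteq> conj_class x"
      using infinite_arbitrarily_large by blast
    then show False using sub[of A] by simp
  qed
  show "card (conj_class x) \<le> n * n" using sub[OF fin] by simp
qed

section \<open>Boundedness and discreteness in the conjugation coarse structure\<close>

lemma conj_coarseE:
  assumes "E \<in> conj_coarse G"
  obtains F where "F \<subseteq> carrier G" "finite F"
    "\<And>x. x \<in> carrier G \<Longrightarrow> E `` {x} \<subseteq> conj_set G x F"
  using assms unfolding conj_coarse_def coarse_generated_def conj_base_def by blast

text \<open>A bounded set is covered by finitely many finite sets x^F. Conversely, a finite set is
  covered by its own image under the diagonal.\<close>

lemma coarse_bounded_conj_coarse_iff:
  "coarse_bounded (carrier G) (conj_coarse G) B \<longleftrightarrow> B \<subseteq> carrier G \<and> finite B"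
proof
  assume "coarse_bounded (carrier G) (conj_coarse G) B"
  then obtain A E where *: "B \<subseteq> carrier G" "finite A" "A \<subseteq> carrier G" "E \<in> conj_coarse G"
    "B \<subseteq> E `` A" by (auto simp: coarse_bounded_def)
  obtain F where F: "finite F" "\<And>x. x \<in> carrier G \<Longrightarrow> E `` {x} \<subseteq> conj_set G x F"
    using conj_coarseE[OF *(4)] by metis
  have "E `` A \<subseteq> (\<Union>x\<in>A. conj_set G x F)"
    using *(3) F(2) unfolding Image_eq_UN[of E A] by (intro UN_mono) auto
  then have "B \<subseteq> (\<Union>x\<in>A. conj_set G x F)" using *(5) by simp
  then show "B \<subseteq> carrier G \<and> finite B"
    using *(1,2) F(1) by (auto simp: conj_set_eq_image intro: finite_subset)
next
  assume B: "B \<subseteq> carrier G \<and> finite B"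
  \<comment> \<open>The base entourage for F = {e} is the diagonal.\<close>
  let ?E = "{(x, y). x \<in> carrier G \<and> y \<in> carrier G \<and> y \<in> conj_set G x {\<one>}}"
  have "?E \<in> conj_base G"
    unfolding conj_base_def by (auto intro!: exI[of _ "{\<one>}"])
  then have "?E \<in> conj_coarse G" using coarse_base_conj_base by (auto simp: coarse_base_def)
  moreover have "B \<subseteq> ?E `` B"
  proof
    fix x assume x: "x \<in> B"
    then have "(x, x) \<in> ?E" using B by (auto simp: conj_set_eq_image)
    then show "x \<in> ?E `` B" using x by (rule ImageI)
  qed
  ultimately show "coarse_bounded (carrier G) (conj_coarse G) B"
    using B unfolding coarse_bounded_def by blast
qed

lemma n_discrete_space_conj_coarse_iff:
  "n_discrete_space (carrier G) (conj_coarse G) n \<longleftrightarrow>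
    (\<forall>F. finite F \<longrightarrow> F \<subseteq> carrier G \<longrightarrow> finite {x \<in> carrier G. n < card (conj_set G x F)})"
proof (intro iffI allI impI)
  fix F assume nd: "n_discrete_space (carrier G) (conj_coarse G) n"
    and F: "finite F" "F \<subseteq> carrier G"
  \<comment> \<open>Entourages in the base need e in F; adding it only enlarges x^F, so a bound for
    the larger set is enough.\<close>
  let ?E = "{(x, y). x \<in> carrier G \<and> y \<in> carrier G \<and> y \<in> conj_set G x (insert \<one> F)}"
  have "?E \<in> conj_base G" using F unfolding conj_base_def by blast
  then have "?E \<in> conj_coarse G" using coarse_base_conj_base by (auto simp: coarse_base_def)
  then obtain B where B: "finite B" "\<And>a. a \<in> carrier G - B \<Longrightarrow>
      finite (?E `` {a} \<inter> carrier G) \<and> card (?E `` {a} \<inter> carrier G) \<le> n"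
    using nd unfolding n_discrete_space_def n_discrete_def coarse_bounded_conj_coarse_iff by meson
  have "card (conj_set G a F) \<le> n" if a: "a \<in> carrier G - B" for a
  proof -
    have "conj_set G a F \<subseteq> ?E `` {a} \<inter> carrier G"
      using a F(2) by (auto simp: conj_set_eq_image)
    then show ?thesis using B(2)[OF a] by (meson card_mono order_trans)
  qed
  then have "{x \<in> carrier G. n < card (conj_set G x F)} \<subseteq> B" using not_le by auto
  then show "finite {x \<in> carrier G. n < card (conj_set G x F)}" using B(1) finite_subset by blast
next
  assume *: "\<forall>F. finite F \<longrightarrow> F \<subseteq> carrier G \<longrightarrow>
    finite {x \<in> carrier G. n < card (conj_set G x F)}"
  have "\<exists>B. B \<subseteq> carrier G \<and> finite B \<and> (\<forall>a\<in>carrier G - B.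
      finite (E `` {a} \<inter> carrier G) \<and> card (E `` {a} \<inter> carrier G) \<le> n)"
    if E: "E \<in> conj_coarse G" for E
  proof -
    obtain F where F: "F \<subseteq> carrier G" "finite F"
      "\<And>x. x \<in> carrier G \<Longrightarrow> E `` {x} \<subseteq> conj_set G x F"
      using conj_coarseE[OF E] by metis
    \<comment> \<open>The exceptional set for F is finite, hence bounded, and can itself be
      removed.\<close>
    let ?B = "{x \<in> carrier G. n < card (conj_set G x F)}"
    have "finite (E `` {a} \<inter> carrier G) \<and> card (E `` {a} \<inter> carrier G) \<le> n"
      if "a \<in> carrier G - ?B" for a
    proof -
      have sub: "E `` {a} \<inter> carrier G \<subseteq> conj_set G a F" using F(3) that by blast
      have fin: "finite (conj_set G a F)" using F(2) by (simp add: conj_set_eq_image)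
      have "card (conj_set G a F) \<le> n" using that by auto
      then show ?thesis
        using card_mono[OF fin sub] finite_subset[OF sub fin] by simp
    qed
    then show ?thesis using * F(1,2) by (intro exI[of _ ?B]) blast
  qed
  then show "n_discrete_space (carrier G) (conj_coarse G) n"
    unfolding n_discrete_space_def n_discrete_def coarse_bounded_conj_coarse_iff by auto
qed

section \<open>Cosets of the commutant and the equivalence\<close>

text \<open>The identity g^-1 x g = x [x^-1, g^-1] puts all conjugates of x into one coset.\<close>

lemma conj_set_subset_derived_coset:
  assumes "x \<in> carrier G" "F \<subseteq> carrier G"
  shows "conj_set G x F \<subseteq> (\<lambda>d. x \<otimes> d) ` derived G (carrier G)"
proof
  fix w assume "w \<in> conj_set G x F"
  then obtain g where g: "g \<in> carrier G" "w = inv g \<otimes> x \<otimes> g"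
    using assms(2) by (auto simp: conj_set_def)
  \<comment> \<open>The double inverses keep the commutator in the form that
    \<open>derived_setI\<close> matches.\<close>
  let ?d = "inv x \<otimes> inv g \<otimes> inv (inv x) \<otimes> inv (inv g)"
  have "w = x \<otimes> ?d" using assms(1) g by (simp add: m_assoc)
  moreover have "?d \<in> derived G (carrier G)"
    unfolding derived_def using assms(1) g(1) by (intro generate.incl derived_setI) auto
  ultimately show "w \<in> (\<lambda>d. x \<otimes> d) ` derived G (carrier G)" by blast
qed

end

theorem theorem3:
  fixes G :: "('a, 'b) monoid_scheme"
  assumes "group G"
  shows "(\<exists>n::nat. n_discrete_space (carrier G) (conj_coarse G) n) \<longleftrightarrow>
         finite (derived G (carrier G))"
proof -
  interpret group G by fact
  show ?thesis
  proof
    assume "\<exists>n. n_discrete_space (carrier G) (conj_coarse G) n"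
    then obtain n where disc: "\<And>F. finite F \<Longrightarrow> F \<subseteq> carrier G \<Longrightarrow>
        finite {x \<in> carrier G. n < card (conj_set G x F)}"
      unfolding n_discrete_space_conj_coarse_iff by blast
    show "finite (derived G (carrier G))"
    \<comment> \<open>The bound on conjugacy classes needs room outside a finite exceptional set, so
      finite groups are treated directly.\<close>
    proof (cases "finite (carrier G)")
      case True
      then show ?thesis
        using derived_in_carrier finite_subset by blast
    next
      case False
      note bound = conj_class_bound[OF False disc]
      show ?thesis
        by (rule finite_derived_if_finite_derived_set[OF
              finite_derived_set_if_bounded_conj_classes[OF bound] bound(1)])
    qed
  next
    assume fin: "finite (derived G (carrier G))"
    have "card (conj_set G x F) \<le> card (derived G (carrier G))"
      if "x \<in> carrier G" "F \<subseteq> carrier G" for x F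
      using conj_set_subset_derived_coset[OF that] fin by (rule surj_card_le[rotated])
    \<comment> \<open>With n the order of the commutant there are no exceptional elements at
      all.\<close>
    then have "{x \<in> carrier G. card (derived G (carrier G)) < card (conj_set G x F)} = {}"
      if "F \<subseteq> carrier G" for F
      using that by (auto simp: not_less)
    then have "n_discrete_space (carrier G) (conj_coarse G) (card (derived G (carrier G)))"
      unfolding n_discrete_space_conj_coarse_iff by (metis finite.emptyI)
    then show "\<exists>n. n_discrete_space (carrier G) (conj_coarse G) n" ..
  qed
qed

end
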